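(* Let $\Sigma$ be a finite alphabet, let $r\ge 1$, and let $p:\Sigma^*\to\mathbb{R}$ be a string function that is traceable of order $r$. Then $\dim p\le r^2$.
   Context: $\Sigma^*$ is the set of all finite strings over $\Sigma$, including the empty string $\Box$; concatenation is written by juxtaposition. A string function is a map $p:\Sigma^*\to\mathbb{R}$. Its dimension is $\dim p:=\mathrm{rk}\,\mathcal{P}_p$, the rank of its (infinite) Hankel matrix $\mathcal{P}_p:=[p(wv)]_{v,w\in\Sigma^*}$. A string function $p$ is traceable of order $r$ if there are matrices $X_a\in\mathbb{R}^{r\times r}$, $a\in\Sigma$, such that $p(a_1\dots a_n)=\mathrm{tr}(X_{a_n}\cdots X_{a_1})$ for all strings $a_1\dots a_n\in\Sigma^*$ (the empty product being the identity matrix). *)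

theory Defs
  imports
    Complex_Main
    "HOL-Library.Extended_Nat"
    "HOL-Library.Function_Algebras"
    "Jordan_Normal_Form.Matrix"
begin

(* Function_Algebras supplies the pointwise additive structure on functions;
   together with the pointwise scalar multiplication this makes the real-valued
   functions on an arbitrary index type a real vector space. *)
instantiation "fun" :: (type, real_vector) real_vector
begin

definition scaleR_fun :: "real \<Rightarrow> ('a \<Rightarrow> 'b) \<Rightarrow> 'a \<Rightarrow> 'b" where
  "scaleR_fun c f = (\<lambda>x. c *\<^sub>R f x)"

instance
  by standard (auto simp: scaleR_fun_def fun_eq_iff scaleR_add_right scaleR_add_left)

end

(* Rank of a possibly infinite matrix (first argument: row index, second: column
   index), i.e. the dimension of the span of its columns.  The library function
   dim returns the junk value 0 on infinite-dimensional spaces, so that case is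
   split off explicitly. *)
definition matrix_rank :: "('i \<Rightarrow> 'j \<Rightarrow> real) \<Rightarrow> enat" where
  "matrix_rank M =
     (let C = range (\<lambda>j i. M i j) in
      if \<exists>B. finite B \<and> C \<subseteq> span B then enat (dim C) else \<infinity>)"

(* Strings over the alphabet 'a are lists; the entry in row v and column w is p(wv). *)
definition hankel :: "('a list \<Rightarrow> real) \<Rightarrow> 'a list \<Rightarrow> 'a list \<Rightarrow> real" where
  "hankel p v w = p (w @ v)"

definition string_dim :: "('a list \<Rightarrow> real) \<Rightarrow> enat" where
  "string_dim p = matrix_rank (hankel p)"

definition mat_trace :: "'b::comm_monoid_add mat \<Rightarrow> 'b" where
  "mat_trace A = (\<Sum>i<dim_row A. A $$ (i, i))"

(* word_mat r X [a1, ..., an] is X an * ... * X a1: the order is reversed. *)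
fun word_mat :: "nat \<Rightarrow> ('a \<Rightarrow> real mat) \<Rightarrow> 'a list \<Rightarrow> real mat" where
  "word_mat r X [] = 1\<^sub>m r"
| "word_mat r X (a # w) = word_mat r X w * X a"

definition traceable :: "nat \<Rightarrow> ('a list \<Rightarrow> real) \<Rightarrow> bool" where
  "traceable r p \<longleftrightarrow>
     (\<exists>X. (\<forall>a. X a \<in> carrier_mat r r) \<and> (\<forall>w. p w = mat_trace (word_mat r X w)))"

end

theory Submission
  imports Defs
begin

text \<open>
  By linearity of the trace, the Hankel matrix of \<open>p\<close> factors through the space of
  \<open>r \<times> r\<close> matrices: if \<open>M w\<close> is the matrix product belonging to \<open>w\<close>, then
  \<open>p (w @ v) = tr (M v * M w)\<close> is the sum of \<open>(M v)\<^sub>i\<^sub>k (M w)\<^sub>k\<^sub>i\<close> over the \<open>r\<^sup>2\<close> index pairs \<open>(i, k)\<close>.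
\<close>

text \<open>Each column is a combination of the functions \<open>f k\<close> with coefficients
  \<open>g k j\<close>, so all columns lie in the span of at most \<open>card K\<close>
  vectors.\<close>

lemma matrix_rank_le_card:
  fixes M :: "'i \<Rightarrow> 'j \<Rightarrow> real"
  assumes "finite K" and M: "\<And>i j. M i j = (\<Sum>k\<in>K. f k i * g k j)"
  shows "matrix_rank M \<le> enat (card K)"
proof -
  let ?C = "range (\<lambda>j i. M i j)"
  have sum_apply: "sum h K i = (\<Sum>k\<in>K. h k i)" for h :: "_ \<Rightarrow> 'i \<Rightarrow> real" and i
    by (induction K rule: infinite_finite_induct) auto
  have "(\<lambda>i. M i j) = (\<Sum>k\<in>K. g k j *\<^sub>R f k)" for j
    by (simp add: fun_eq_iff M sum_apply scaleR_fun_def mult.commute)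
  moreover have "(\<Sum>k\<in>K. g k j *\<^sub>R f k) \<in> span (f ` K)" for j
    by (intro span_sum span_scale span_base imageI)
  ultimately have sub: "?C \<subseteq> span (f ` K)"
    by auto
  have "dim ?C \<le> card (f ` K)"
    using sub \<open>finite K\<close> by (intro dim_le_card) auto
  also have "\<dots> \<le> card K"
    using \<open>finite K\<close> by (rule card_image_le)
  finally have "dim ?C \<le> card K" .
  \<comment> \<open>The image of \<open>K\<close> under \<open>f\<close> is the witness; it rules
    out the value \<infinity> in \<open>matrix_rank\<close>.\<close>
  moreover have "\<exists>B. finite B \<and> ?C \<subseteq> span B"
    using sub \<open>finite K\<close> by blast
  ultimately show ?thesis
    by (simp add: matrix_rank_def)
qed

lemma word_mat_carrier:
  assumes "\<And>a. X a \<in> carrier_mat r r"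
  shows "word_mat r X w \<in> carrier_mat r r"
  by (induction w) (auto intro: mult_carrier_mat assms)

text \<open>Later letters multiply from the left, hence the swapped factors; in the Hankel entry
  \<open>p (w @ v)\<close> the row word \<open>v\<close> supplies the left factor.\<close>

lemma word_mat_append:
  assumes X: "\<And>a. X a \<in> carrier_mat r r"
  shows "word_mat r X (v @ w) = word_mat r X w * word_mat r X v"
proof (induction v)
  case Nil
  show ?case
    using right_mult_one_mat[OF word_mat_carrier, of X r w] X by simp
next
  case (Cons a v)
  then show ?case
    using assoc_mult_mat[OF word_mat_carrier word_mat_carrier X, of X X w v a] X by simp
qed

lemma mat_trace_mult:
  fixes A B :: "'b::semiring_0 mat"
  assumes "A \<in> carrier_mat m n" "B \<in> carrier_mat n m"
  shows "mat_trace (A * B) = (\<Sum>(i, k)\<in>{..<m} \<times> {..<n}. A $$ (i, k) * B $$ (k, i))"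
  using assms
  by (simp add: mat_trace_def scalar_prod_def sum.cartesian_product[symmetric] lessThan_atLeast0)

theorem theorem7p3:
  fixes p :: "'a::finite list \<Rightarrow> real" and r :: nat
  assumes "r \<ge> 1"
    and "traceable r p"
  shows "string_dim p \<le> enat (r\<^sup>2)"
proof -
  obtain X where X: "\<And>a. X a \<in> carrier_mat r r"
    and p: "\<And>w. p w = mat_trace (word_mat r X w)"
    using assms(2) by (auto simp: traceable_def)
  let ?K = "{..<r} \<times> {..<r}"
  \<comment> \<open>This separates the words: \<open>v\<close> enters only the first factor,
    \<open>w\<close> only the second, as \<open>matrix_rank_le_card\<close> requires.\<close>
  have "hankel p v w =
      (\<Sum>ik\<in>?K. word_mat r X v $$ ik * word_mat r X w $$ (snd ik, fst ik))" for v w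
    using mat_trace_mult[OF word_mat_carrier word_mat_carrier, of X r X v w] X
    by (simp add: hankel_def p word_mat_append case_prod_unfold)
  then have "matrix_rank (hankel p) \<le> enat (card ?K)"
    by (intro matrix_rank_le_card) auto
  then show ?thesis
    by (simp add: string_dim_def power2_eq_square)
qed

end
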